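(* There exist an infinite set $N \subseteq \mathbb{N}$ and a function $\varepsilon: N \to \mathbb{R}$ with $\varepsilon(n) \to 0$ as $n \to \infty$ within $N$, such that for every $n \in N$ there exists a tournament $D$ on $2n$ vertices with the following properties: the minimum out-degree of $D$ is $s = n-1$, and every subdigraph $D'$ of $D$ with exactly $n$ vertices satisfies $$\delta^+(D') \le \frac{s}{2} - \left(\frac{1}{2} + \varepsilon(n)\right)\log_3(s).$$
   Context: Digraphs have no loops or parallel arcs. A tournament is a digraph in which for every pair of distinct vertices $u,v$ exactly one of the arcs $(u,v)$, $(v,u)$ is present. A subdigraph of $D$ is a digraph whose vertex set is a subset of $V(D)$ and whose arc set is a subset of the arcs of $D$ between those vertices. $\delta^+(D)$ denotes the minimum out-degree of $D$ (the smallest out-degree among its vertices), defined as $0$ for the empty digraph. *)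

theory Defs
  imports Complex_Main "Graph_Theory.Digraph_Component"
begin

(* The locale digraph bundles finiteness, no loops and no parallel arcs. *)
definition tournament :: "('a, 'b) pre_digraph \<Rightarrow> bool" where
  "tournament G \<longleftrightarrow> digraph G \<and>
     (\<forall>u \<in> verts G. \<forall>v \<in> verts G. u \<noteq> v \<longrightarrow>
        ((u, v) \<in> arcs_ends G) \<noteq> ((v, u) \<in> arcs_ends G))"

definition min_out_degree :: "('a, 'b) pre_digraph \<Rightarrow> nat" where
  "min_out_degree G = (if verts G = {} then 0 else Min (out_degree G ` verts G))"

end

theory Submission
  imports Defs "HOL-Real_Asymp.Real_Asymp"
begin

text \<open>
  Let T(k) be the k-fold iterated substitution of tournaments into a directed triangle, a regular
  tournament on 3^k vertices, and add a vertex dominating everything; then 2n = 3^k + 1.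
  For a set X of m vertices of T(k) we bound the excess 2 d(v) - m of some vertex v in X by
  - k + |2m - 3^k|/2 - 1/2, by descending through the levels of T(k). If the three blocks meet X in
  a, b, c vertices (in cyclic order), then passing from X to its part in the first block changes
  the excess by b - c. Two of the three sizes lie on the same side of half the block size, and any
  two blocks are cyclically consecutive, which always yields a block for which the change pays for
  the change of the bound. Only empty and full blocks need a separate treatment.
  For m = n or m = n - 1 the bound is about - k, where k is about the logarithm of n in base 3.
\<close>

section \<open>The iterated triangle and its blocks\<close>

text \<open>Vertices of T(k) are numbers with \<open>k\<close> ternary digits, the leading digit
  naming the block; the most significant digit in which \<open>u\<close> and \<open>v\<close> differ
  decides the arc.\<close>

fun cyc3 :: "nat \<Rightarrow> nat \<Rightarrow> nat \<Rightarrow> bool" where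
  "cyc3 0 u v = False"
| "cyc3 (Suc k) u v =
     (if u div 3 ^ k = v div 3 ^ k then cyc3 k (u mod 3 ^ k) (v mod 3 ^ k)
      else v div 3 ^ k = (u div 3 ^ k + 1) mod 3)"

definition outdeg_in :: "nat \<Rightarrow> nat set \<Rightarrow> nat \<Rightarrow> nat" where
  "outdeg_in k X v = card {w \<in> X. cyc3 k v w}"

text \<open>Shifting the trace of \<open>X\<close> on a block down to \<open>{..<3 ^ k}\<close>
  makes it a vertex set of T(k), ready for induction.\<close>

definition part :: "nat \<Rightarrow> nat set \<Rightarrow> nat \<Rightarrow> nat set" where
  "part k X i = {x. x < 3 ^ k \<and> x + i * 3 ^ k \<in> X}"

lemma cyc3_irrefl: "\<not> cyc3 k u u"
  by (induction k arbitrary: u) auto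

lemma mod_3_succ:
  fixes a b :: nat
  assumes "a < 3" "b < 3" "a \<noteq> b"
  shows "(b = (a + 1) mod 3) \<noteq> (a = (b + 1) mod 3)"
proof -
  have "a = 0 \<or> a = 1 \<or> a = 2" "b = 0 \<or> b = 1 \<or> b = 2" using assms(1,2) by auto
  then show ?thesis using assms(3) by (elim disjE) simp_all
qed

lemma cyc3_tournament:
  assumes "u < 3 ^ k" "v < 3 ^ k" "u \<noteq> v"
  shows "cyc3 k u v \<noteq> cyc3 k v u"
  using assms
proof (induction k arbitrary: u v)
  case 0
  then show ?case by simp
next
  case (Suc k)
  show ?case
  proof (cases "u div 3 ^ k = v div 3 ^ k")
    case True
    then have "u mod 3 ^ k \<noteq> v mod 3 ^ k"
      using Suc.prems(3) by (metis div_mult_mod_eq)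
    with True Suc.IH[of "u mod 3 ^ k" "v mod 3 ^ k"] show ?thesis by simp
  next
    case False
    have "u div 3 ^ k < 3" "v div 3 ^ k < 3"
      using Suc.prems by (simp_all add: less_mult_imp_div_less)
    then have "(v div 3 ^ k = (u div 3 ^ k + 1) mod 3) \<noteq> (u div 3 ^ k = (v div 3 ^ k + 1) mod 3)"
      using False by (rule mod_3_succ)
    with False show ?thesis by simp
  qed
qed

lemma finite_part [simp]: "finite (part k X i)"
  by (rule finite_subset[of _ "{..<3 ^ k}"]) (auto simp: part_def)

lemma part_subset: "part k X i \<subseteq> {..<3 ^ k}"
  by (auto simp: part_def)

lemma inj_on_block: "inj_on (\<lambda>x. x + c) (A :: nat set)"
  by (auto simp: inj_on_def)

lemma block_eq_part:
  assumes "X \<subseteq> {..<3 ^ Suc k}"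
  shows "{w \<in> X. w div 3 ^ k = i} = (\<lambda>x. x + i * 3 ^ k) ` part k X i"
proof (intro set_eqI iffI)
  fix w assume "w \<in> {w \<in> X. w div 3 ^ k = i}"
  then have "w = w mod 3 ^ k + i * 3 ^ k" "w \<in> X"
    by (auto simp: mod_div_mult_eq)
  then show "w \<in> (\<lambda>x. x + i * 3 ^ k) ` part k X i"
    by (intro image_eqI[of _ _ "w mod 3 ^ k"]) (auto simp: part_def)
qed (auto simp: part_def)

lemma card_block:
  assumes "X \<subseteq> {..<3 ^ Suc k}"
  shows "card {w \<in> X. w div 3 ^ k = i} = card (part k X i)"
  unfolding block_eq_part[OF assms] by (rule card_image[OF inj_on_block])

lemma card_eq_parts:
  assumes "X \<subseteq> {..<3 ^ Suc k}"
  shows "card X = card (part k X 0) + card (part k X 1) + card (part k X 2)"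
proof -
  let ?B = "\<lambda>i. {w \<in> X. w div 3 ^ k = i}"
  have fin: "finite X" using assms finite_subset by blast
  have "w div 3 ^ k \<in> {0, 1, 2}" if "w \<in> X" for w
  proof -
    have "w div 3 ^ k < 3"
      using that assms by (auto simp: less_mult_imp_div_less)
    then show ?thesis by auto
  qed
  then have "X = ?B 0 \<union> ?B 1 \<union> ?B 2" by auto
  then have "card X = card (?B 0 \<union> ?B 1 \<union> ?B 2)" by simp
  also have "\<dots> = card (?B 0) + card (?B 1) + card (?B 2)"
    using fin by (subst card_Un_disjoint; auto)+
  finally show ?thesis by (simp add: card_block[OF assms])
qed

text \<open>A vertex sees a copy of T(k) in its own block, dominates the next block and is dominated
  by the third.\<close>

lemma outdeg_in_Suc:
  assumes "X \<subseteq> {..<3 ^ Suc k}" "i < 3" "y < 3 ^ k"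
  shows "outdeg_in (Suc k) X (y + i * 3 ^ k) =
           outdeg_in k (part k X i) y + card (part k X ((i + 1) mod 3))"
proof -
  let ?j = "(i + 1) mod 3"
  have ij: "i \<noteq> ?j" using assms(2) by presburger
  have fin: "finite X" using assms(1) finite_subset by blast
  have div: "(y + i * 3 ^ k) div 3 ^ k = i" and mod: "(y + i * 3 ^ k) mod 3 ^ k = y"
    using assms(3) by auto
  have "cyc3 (Suc k) (y + i * 3 ^ k) w =
      (if i = w div 3 ^ k then cyc3 k y (w mod 3 ^ k) else w div 3 ^ k = ?j)" for w
    by (simp only: cyc3.simps div mod)
  then have "{w \<in> X. cyc3 (Suc k) (y + i * 3 ^ k) w} =
      {w \<in> {w \<in> X. w div 3 ^ k = i}. cyc3 k y (w mod 3 ^ k)} \<union> {w \<in> X. w div 3 ^ k = ?j}"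
    using ij by auto
  also have "{w \<in> {w \<in> X. w div 3 ^ k = i}. cyc3 k y (w mod 3 ^ k)} =
      (\<lambda>x. x + i * 3 ^ k) ` {x \<in> part k X i. cyc3 k y x}"
    unfolding block_eq_part[OF assms(1)] by (auto simp: part_def)
  finally have "{w \<in> X. cyc3 (Suc k) (y + i * 3 ^ k) w} =
      (\<lambda>x. x + i * 3 ^ k) ` {x \<in> part k X i. cyc3 k y x} \<union> {w \<in> X. w div 3 ^ k = ?j}" .
  then have "outdeg_in (Suc k) X (y + i * 3 ^ k) =
      card ((\<lambda>x. x + i * 3 ^ k) ` {x \<in> part k X i. cyc3 k y x}) + card {w \<in> X. w div 3 ^ k = ?j}"
    unfolding outdeg_in_def using fin ij
    by (simp only:, subst card_Un_disjoint) (auto simp: part_def)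
  then show ?thesis
    unfolding outdeg_in_def by (simp add: card_image[OF inj_on_block] card_block[OF assms(1)])
qed

lemma part_full: "i < 3 \<Longrightarrow> part k {..<3 ^ Suc k} i = {..<3 ^ k}"
proof -
  assume "i < 3"
  then have "i * 3 ^ k \<le> 2 * 3 ^ k" by (intro mult_right_mono) auto
  moreover have "x + i * 3 ^ k < 3 ^ Suc k" if "x < 3 ^ k" for x
    using that \<open>i * 3 ^ k \<le> 2 * 3 ^ k\<close> unfolding power_Suc by linarith
  ultimately show ?thesis by (auto simp: part_def)
qed

text \<open>Regularity of T(k): the next block contributes \<open>3 ^ k\<close>, the own block half
  of \<open>3 ^ k - 1\<close>.\<close>

lemma outdeg_in_full:
  assumes "v < 3 ^ k"
  shows "2 * outdeg_in k {..<3 ^ k} v + 1 = 3 ^ k"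
  using assms
proof (induction k arbitrary: v)
  case 0
  then show ?case by (simp add: outdeg_in_def)
next
  case (Suc k)
  define i y where "i = v div 3 ^ k" and "y = v mod 3 ^ k"
  have v: "v = y + i * 3 ^ k" and y: "y < 3 ^ k" and i: "i < 3"
    using Suc.prems by (simp_all add: i_def y_def less_mult_imp_div_less mod_div_mult_eq)
  have "outdeg_in (Suc k) {..<3 ^ Suc k} v = outdeg_in k {..<3 ^ k} y + 3 ^ k"
    unfolding v by (subst outdeg_in_Suc) (use i y in \<open>auto simp: part_full simp del: power_Suc\<close>)
  with Suc.IH[OF y] show ?case by simp
qed

section \<open>Descent to a vertex of low out-degree\<close>

text \<open>Twice the excess changes by 2(b - c) in the descent; the second alternative of good ends the
  descent in a full block, where all vertices have excess - 1.\<close>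
lemma descent:
  fixes x y z K \<delta> :: int
  assumes "odd K" "0 \<le> x" "x \<le> K" "0 \<le> y" "y \<le> K" "0 \<le> z" "z \<le> K" "x + y + z > 0"
    and \<delta>: "\<delta> = \<bar>2 * (x + y + z) - 3 * K\<bar>"
  defines "good \<equiv> \<lambda>a b c. a > 0 \<and>
     (2 * (b - c) + \<bar>2 * a - K\<bar> + 2 \<le> \<delta> \<or> a = K \<and> 2 * (b - c) + K \<le> \<delta>)"
  shows "good x y z \<or> good y z x \<or> good z x y"
proof -
  \<comment> \<open>As \<open>K\<close> is odd, every size is at most \<open>p\<close> or at least
    \<open>p + 1\<close>, never half of \<open>K\<close>; this gap supplies the 2 in
    \<open>good\<close>.\<close>
  obtain p where K: "K = 2 * p + 1" using assms(1) by (elim oddE)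
  then have p: "p \<ge> 0" using assms(2,3) by linarith
  have \<delta>: "2 * (x + y + z) - 3 * K \<le> \<delta>" "3 * K - 2 * (x + y + z) \<le> \<delta>"
    unfolding \<delta> by linarith+
  \<comment> \<open>Against the first bound on \<delta>, the claim reduces to
    \<open>2 * c >= K + 1\<close>.\<close>
  have large: "good a b c" if "a > p" "c > p" "a + b + c = x + y + z" for a b c
  proof -
    have "\<bar>2 * a - K\<bar> = 2 * a - K" using that K by simp
    then show ?thesis using that p K \<delta>(1) unfolding good_def by simp
  qed
  \<comment> \<open>Against the second bound on \<delta>, the claim reduces to
    \<open>2 * b + 1 <= K\<close>.\<close>
  have small: "good a b c" if "0 < a" "a \<le> p" "b \<le> p" "a + b + c = x + y + z" for a b c
  proof -
    have "\<bar>2 * a - K\<bar> = K - 2 * a" using that K by simp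
    then show ?thesis using that K \<delta>(2) unfolding good_def by simp
  qed
  \<comment> \<open>Replaces \<open>small\<close> when the block to descend into is empty. The first
    alternative amounts to \<open>2 * c + 1 <= 2 * K\<close>, which fails only for a full block;
    there the second one holds.\<close>
  have empty: "good c 0 b" if "0 \<le> b" "b \<le> p" "p < c" "c \<le> K" "b + c = x + y + z" for b c
  proof -
    have "\<bar>2 * c - K\<bar> = 2 * c - K" using that K by simp
    then show ?thesis using that p K \<delta>(2) unfolding good_def by (cases "c = K") auto
  qed
  \<comment> \<open>Descend into \<open>a\<close> if possible. If \<open>a = 0\<close> and
    \<open>c\<close> is small, descend into \<open>c\<close>, or into \<open>b\<close> when
    \<open>c = 0\<close>; if \<open>c\<close> is large, use \<open>empty\<close>.\<close>
  have two_small: "good a b c \<or> good b c a \<or> good c a b"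
    if "0 \<le> a" "a \<le> p" "0 \<le> b" "b \<le> p" "0 \<le> c" "c \<le> K" "a + b + c = x + y + z" for a b c
    using that assms(8) small[of a b c] small[of b c a] small[of c a b] empty[of b c]
    by (cases "a = 0"; cases "b = 0"; cases "c \<le> p") auto
  consider "x > p" "z > p" | "y > p" "x > p" | "z > p" "y > p"
    | "x \<le> p" "y \<le> p" | "y \<le> p" "z \<le> p" | "z \<le> p" "x \<le> p" by linarith
  then show ?thesis
  proof cases
    case 1 then show ?thesis using large[of x z y] by simp
  next
    case 2 then show ?thesis using large[of y x z] by simp
  next
    case 3 then show ?thesis using large[of z y x] by simp
  next
    case 4 then show ?thesis using two_small[of x y z] assms(2-7) by simp
  next
    case 5 then show ?thesis using two_small[of y z x] assms(2-7) by auto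
  next
    case 6 then show ?thesis using two_small[of z x y] assms(2-7) by auto
  qed
qed

text \<open>The bound on the excess, doubled to clear the halves.\<close>

lemma exists_low_outdeg:
  assumes "X \<subseteq> {..<3 ^ k}" "X \<noteq> {}"
  shows "\<exists>v\<in>X. 4 * int (outdeg_in k X v) + 2 * int k + 1
           \<le> 2 * int (card X) + \<bar>2 * int (card X) - 3 ^ k\<bar>"
  using assms
proof (induction k arbitrary: X)
  case 0
  then have "X = {0}" by auto
  then show ?case by (simp add: outdeg_in_def)
next
  case (Suc k)
  define p where "p = part k X"
  define x where "x = (\<lambda>i. int (card (p i)))"
  define \<delta> where "\<delta> = \<bar>2 * int (card X) - 3 ^ Suc k\<bar>"
  have sum: "int (card X) = x 0 + x 1 + x 2"
    unfolding x_def p_def by (simp add: card_eq_parts[OF Suc.prems(1)])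
  have le: "x i \<le> 3 ^ k" for i
  proof -
    have "card (p i) \<le> 3 ^ k"
      using card_mono[OF _ part_subset[of k X i]] unfolding p_def by simp
    then have "int (card (p i)) \<le> int (3 ^ k)" by (rule of_nat_mono)
    then show ?thesis unfolding x_def by simp
  qed
  have "finite X" using Suc.prems(1) finite_subset by blast
  then have pos: "x 0 + x 1 + x 2 > 0"
    unfolding sum[symmetric] using Suc.prems(2) by (simp add: card_gt_0_iff)
  define good where "good = (\<lambda>i j l. x i > 0 \<and>
     (2 * (x j - x l) + \<bar>2 * x i - 3 ^ k\<bar> + 2 \<le> \<delta> \<or> x i = 3 ^ k \<and> 2 * (x j - x l) + 3 ^ k \<le> \<delta>))"
  have "good 0 1 2 \<or> good 1 2 0 \<or> good 2 0 1"
    unfolding good_def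
    by (rule descent) (use le pos in \<open>simp_all add: \<delta>_def sum, simp_all add: x_def\<close>)
  then have "\<exists>i\<in>{0, 1, 2}. good i ((i + 1) mod 3) ((i + 2) mod 3)"
    by (simp add: mod_Suc numeral_2_eq_2)
  then obtain i where i: "i \<in> {0, 1, 2}" "good i ((i + 1) mod 3) ((i + 2) mod 3)" by blast
  then have "i < 3" by auto
  define j l where "j = (i + 1) mod 3" and "l = (i + 2) mod 3"
  have sum': "int (card X) = x i + x j + x l"
    using i(1) unfolding sum j_def l_def by (auto simp: numeral_2_eq_2)
  have good: "good i j l" using i unfolding j_def l_def by simp
  have p: "p i \<subseteq> {..<3 ^ k}" "p i \<noteq> {}"
    using good part_subset unfolding p_def good_def x_def by auto
  \<comment> \<open>For a full block, regularity replaces the induction hypothesis, and the spare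
    \<open>3 ^ k\<close> of the second alternative must pay for the whole term in
    \<open>k\<close>.\<close>
  have k: "2 * int k + 1 \<le> 3 ^ k" by (induction k) auto
  have "\<exists>y\<in>p i. 4 * int (outdeg_in k (p i) y) + 4 * x j + 2 * int (Suc k) + 1 \<le>
          2 * int (card X) + \<delta>"
  proof (cases "x i = 3 ^ k \<and> 2 * (x j - x l) + 3 ^ k \<le> \<delta>")
    case True
    then have "card (p i) = 3 ^ k" unfolding x_def
      by (metis of_nat_eq_iff of_nat_numeral of_nat_power)
    then have full: "p i = {..<3 ^ k}"
      using p by (intro card_subset_eq) auto
    obtain y where y: "y \<in> p i" using p by auto
    then have "2 * int (outdeg_in k (p i) y) + 1 = 3 ^ k"
      using outdeg_in_full[of y k] unfolding full
      by (metis lessThan_iff of_nat_1 of_nat_add of_nat_mult of_nat_numeral of_nat_power)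
    then show ?thesis using True k y unfolding sum' by (intro bexI[of _ y]) auto
  next
    case False
    \<comment> \<open>The 2 in the first alternative pays for \<open>2 * int k\<close> growing to
      \<open>2 * int (Suc k)\<close>.\<close>
    obtain y where y: "y \<in> p i" "4 * int (outdeg_in k (p i) y) + 2 * int k + 1
           \<le> 2 * x i + \<bar>2 * x i - 3 ^ k\<bar>"
      using Suc.IH[OF p] unfolding x_def by blast
    then show ?thesis using False good unfolding sum' good_def by (intro bexI[of _ y]) auto
  qed
  then obtain y where y: "y \<in> p i" "4 * int (outdeg_in k (p i) y) + 4 * x j + 2 * int (Suc k) + 1 \<le>
          2 * int (card X) + \<delta>" by blast
  have "y < 3 ^ k" "y + i * 3 ^ k \<in> X" using y(1) unfolding p_def part_def by auto
  moreover have "int (outdeg_in (Suc k) X (y + i * 3 ^ k)) = int (outdeg_in k (p i) y) + x j"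
    using outdeg_in_Suc[OF Suc.prems(1) \<open>i < 3\<close> \<open>y < 3 ^ k\<close>] unfolding p_def x_def j_def by simp
  ultimately show ?case using y(2) unfolding \<delta>_def
    by (intro bexI[of _ "y + i * 3 ^ k"]) auto
qed

section \<open>Adding the dominating vertex\<close>

text \<open>The apex makes the order even and leaves the out-degrees in T(k) unchanged.\<close>

definition cyc3_apex :: "nat \<Rightarrow> (nat, nat \<times> nat) pre_digraph" where
  "cyc3_apex k = \<lparr>verts = {..3 ^ k},
     arcs = {(u, v). v < 3 ^ k \<and> (u = 3 ^ k \<or> u < 3 ^ k \<and> cyc3 k u v)},
     tail = fst, head = snd\<rparr>"

lemma tournament_cyc3_apex: "tournament (cyc3_apex k)"
proof -
  let ?D = "cyc3_apex k"
  have "finite (arcs ?D)"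
    by (rule finite_subset[of _ "{..3 ^ k} \<times> {..3 ^ k}"]) (auto simp: cyc3_apex_def)
  then have "digraph ?D"
    by unfold_locales (auto simp: cyc3_apex_def cyc3_irrefl arc_to_ends_def)
  moreover have "((u, v) \<in> arcs_ends ?D) \<noteq> ((v, u) \<in> arcs_ends ?D)"
    if "u \<in> verts ?D" "v \<in> verts ?D" "u \<noteq> v" for u v
    using that cyc3_tournament[of u k v]
    by (auto simp: cyc3_apex_def arcs_ends_def arc_to_ends_def image_iff)
  ultimately show ?thesis unfolding tournament_def by blast
qed

lemma out_degree_cyc3_apex:
  assumes "v \<le> 3 ^ k"
  shows "out_degree (cyc3_apex k) v = (if v = 3 ^ k then 3 ^ k else (3 ^ k - 1) div 2)"
proof -
  have arcs: "out_arcs (cyc3_apex k) v =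
      Pair v ` (if v = 3 ^ k then {..<3 ^ k} else {w \<in> {..<3 ^ k}. cyc3 k v w})"
    using assms by (auto simp: out_arcs_def cyc3_apex_def)
  have "v \<noteq> 3 ^ k \<Longrightarrow> outdeg_in k {..<3 ^ k} v = (3 ^ k - 1) div 2"
    using outdeg_in_full[of v k] assms by simp
  then show ?thesis
    unfolding out_degree_def arcs by (simp add: card_image inj_on_def outdeg_in_def)
qed

lemma min_out_degree_cyc3_apex: "min_out_degree (cyc3_apex k) = (3 ^ k - 1) div 2"
proof -
  have "Min (out_degree (cyc3_apex k) ` {..3 ^ k}) = (3 ^ k - 1) div 2"
  proof (rule Min_eqI)
    show "(3 ^ k - 1) div 2 \<in> out_degree (cyc3_apex k) ` {..3 ^ k}"
      by (rule image_eqI[of _ _ 0]) (auto simp: out_degree_cyc3_apex)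
  qed (auto simp: out_degree_cyc3_apex)
  then show ?thesis by (simp add: min_out_degree_def cyc3_apex_def)
qed

text \<open>Without the apex, m = n or m = n - 1 vertices remain. Either way 2m differs from
  \<open>3 ^ k\<close> by exactly 1, so some vertex has 4d + 2k <= 2m <= 2n.\<close>

lemma min_out_degree_subgraph_cyc3_apex:
  assumes sub: "subgraph H (cyc3_apex k)"
    and card: "2 * card (verts H) = 3 ^ k + 1" and k: "k > 0"
  shows "2 * min_out_degree H + k \<le> card (verts H)"
proof -
  let ?X = "verts H - {3 ^ k}"
  have verts: "verts H \<subseteq> {..3 ^ k}" and arcs: "arcs H \<subseteq> arcs (cyc3_apex k)"
    and H: "wf_digraph H" and "compatible (cyc3_apex k) H"
    using sub by (auto simp: subgraph_def cyc3_apex_def)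
  then have tail: "tail H = fst" and head: "head H = snd"
    by (auto simp: compatible_def cyc3_apex_def)
  have fin: "finite (verts H)" using verts finite_subset by blast
  \<comment> \<open>\<open>k > 0\<close> excludes that \<open>H\<close> is the apex alone.\<close>
  have "3 ^ 1 \<le> (3 :: nat) ^ k" using k by (intro power_increasing) auto
  then have "card (verts H) \<ge> 2" using card by simp
  then have "card ?X > 0" using fin by (simp add: card_Diff_singleton_if)
  then have X: "?X \<subseteq> {..<3 ^ k}" "?X \<noteq> {}" using verts by (auto simp: card_gt_0_iff)
  obtain v where v: "v \<in> ?X" "4 * int (outdeg_in k ?X v) + 2 * int k + 1
           \<le> 2 * int (card ?X) + \<bar>2 * int (card ?X) - 3 ^ k\<bar>"
    using exists_low_outdeg[OF X] by blast
  have "min_out_degree H \<le> out_degree H v"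
    using v(1) fin by (auto simp: min_out_degree_def)
  \<comment> \<open>No arc enters the apex, so the out-neighbours of \<open>v\<close> in
    \<open>H\<close> lie in \<open>?X\<close>; \<open>H\<close> may omit arcs, hence only an
    inequality.\<close>
  also have "\<dots> \<le> outdeg_in k ?X v"
    unfolding out_degree_def outdeg_in_def
  proof (rule card_inj_on_le)
    show "inj_on snd (out_arcs H v)"
      by (auto simp: inj_on_def out_arcs_def tail)
    show "snd ` out_arcs H v \<subseteq> {w \<in> ?X. cyc3 k v w}"
      using v(1) arcs wf_digraph.head_in_verts[OF H]
      by (auto simp: out_arcs_def tail head cyc3_apex_def)
  qed (use fin in auto)
  finally have "min_out_degree H \<le> outdeg_in k ?X v" .
  moreover have "2 * int (card (verts H)) = 3 ^ k + 1"
    using arg_cong[OF card, of int] by simp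
  moreover have "int (card ?X) = int (card (verts H)) - (if 3 ^ k \<in> verts H then 1 else 0)"
    using fin \<open>card (verts H) \<ge> 2\<close> by (auto simp: card_Diff_singleton_if of_nat_diff)
  ultimately show ?thesis using v(2) by (auto split: if_splits)
qed

section \<open>Choice of the orders and of the error term\<close>

theorem theorem1:
  shows "\<exists>(N :: nat set) (\<epsilon> :: nat \<Rightarrow> real).
    infinite N \<and> N \<subseteq> {2..} \<and>
    (\<epsilon> \<longlongrightarrow> 0) (inf sequentially (principal N)) \<and>
    (\<forall>n \<in> N. \<exists>D :: (nat, nat \<times> nat) pre_digraph. let s = n - 1 in
       tournament D \<and> card (verts D) = 2 * n \<and>
       min_out_degree D = s \<and>
       (\<forall>D'. subgraph D' D \<and> card (verts D') = n \<longrightarrow>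
          real (min_out_degree D') \<le> real s / 2 - (1 / 2 + \<epsilon> n) * log 3 (real s)))"
proof -
  define f where "f k = (3 ^ k + 1) div (2 :: nat)" for k :: nat
  \<comment> \<open>With s = n - 1, the factor 1/2 + \<epsilon> turns \<open>log 3 s\<close> into
    \<open>(log 3 s - 1) / 2\<close>; this absorbs the 1 in 2d <= s + 1 - k, where
    \<open>log 3 s <= k\<close>.\<close>
  define \<epsilon> where "\<epsilon> n = - 1 / (2 * log 3 (real n - 1))" for n :: nat
  have f: "2 * f k = 3 ^ k + 1" for k unfolding f_def by simp
  have "strict_mono f"
  proof (rule strict_mono_Suc_iff[THEN iffD2], rule allI)
    show "f k < f (Suc k)" for k
      using f[of k] f[of "Suc k"] zero_less_power[of "3 :: nat" k] unfolding power_Suc by linarith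
  qed
  \<comment> \<open>Starting at \<open>k = 2\<close> keeps \<open>log 3 (n - 1)\<close>, the divisor
    in \<epsilon>, positive.\<close>
  then have inf: "infinite (f ` {2..})"
    by (meson finite_imageD infinite_Ici inj_on_subset strict_mono_imp_inj_on subset_UNIV)
  have f5: "f k \<ge> 5" if "k \<ge> 2" for k
    using power_increasing[OF that, of "3 :: nat"] f[of k] by simp
  have lim: "(\<epsilon> \<longlongrightarrow> 0) (inf sequentially (principal (f ` {2..})))"
  proof (rule tendsto_mono[OF inf_le1])
    show "\<epsilon> \<longlonglongrightarrow> 0" unfolding \<epsilon>_def by real_asymp
  qed
  have bound: "real d \<le> real (f k - 1) / 2 - (1 / 2 + \<epsilon> (f k)) * log 3 (real (f k - 1))"
    if k: "k \<ge> 2" and d: "2 * d + k \<le> f k" for k d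
  proof -
    let ?s = "real (f k - 1)"
    have s: "?s = real (f k) - 1" "?s > 1" using f5[OF k] by (auto simp: of_nat_diff)
    have "real (f k - 1) \<le> real (3 ^ k)" using f[of k] by (intro of_nat_mono) linarith
    then have "log 3 ?s \<le> real k" using s(2) by (subst log_le_iff) (auto simp: powr_realpow)
    moreover have "log 3 ?s > 0" using s(2) by simp
    then have "(1 / 2 + \<epsilon> (f k)) * log 3 ?s = log 3 ?s / 2 - 1 / 2"
      unfolding \<epsilon>_def s(1)[symmetric] by (simp add: field_simps)
    moreover have "2 * real d + real k \<le> ?s + 1" using d s(1) by linarith
    ultimately show ?thesis by (simp add: field_simps)
  qed
  have D: "let s = f k - 1 in
       tournament (cyc3_apex k) \<and> card (verts (cyc3_apex k)) = 2 * f k \<and>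
       min_out_degree (cyc3_apex k) = s \<and>
       (\<forall>D'. subgraph D' (cyc3_apex k) \<and> card (verts D') = f k \<longrightarrow>
          real (min_out_degree D') \<le> real s / 2 - (1 / 2 + \<epsilon> (f k)) * log 3 (real s))"
    if k: "k \<ge> 2" for k
    unfolding Let_def
  proof (intro conjI allI impI)
    show "tournament (cyc3_apex k)" by (rule tournament_cyc3_apex)
    show "card (verts (cyc3_apex k)) = 2 * f k" unfolding f by (simp add: cyc3_apex_def)
    show "min_out_degree (cyc3_apex k) = f k - 1"
      using f[of k] unfolding min_out_degree_cyc3_apex by linarith
  next
    fix D' assume "subgraph D' (cyc3_apex k) \<and> card (verts D') = f k"
    then have "2 * min_out_degree D' + k \<le> f k"
      using min_out_degree_subgraph_cyc3_apex[of D' k] f k by auto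
    then show "real (min_out_degree D') \<le> real (f k - 1) / 2
        - (1 / 2 + \<epsilon> (f k)) * log 3 (real (f k - 1))"
      by (rule bound[OF k])
  qed
  have "f ` {2..} \<subseteq> {2..}" using f5 by force
  moreover have "\<exists>D :: (nat, nat \<times> nat) pre_digraph. let s = n - 1 in
       tournament D \<and> card (verts D) = 2 * n \<and> min_out_degree D = s \<and>
       (\<forall>D'. subgraph D' D \<and> card (verts D') = n \<longrightarrow>
          real (min_out_degree D') \<le> real s / 2 - (1 / 2 + \<epsilon> n) * log 3 (real s))"
    if n: "n \<in> f ` {2..}" for n
  proof -
    obtain k where k: "k \<ge> 2" "n = f k" using n by auto
    show ?thesis unfolding k(2) by (intro exI[of _ "cyc3_apex k"] D k(1))
  qed
  ultimately show ?thesis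
    using inf lim by (intro exI[of _ "f ` {2..}"] exI[of _ \<epsilon>] conjI ballI)
qed

end
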